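(* Let $\mathbb{F}=\mathbb{R}$ or $\mathbb{F}=\mathbb{C}$. For an arbitrary $w\in\mathbb{F}$ with $|w|>1$, the bounded linear operator \[ c(\mathbb{N})\ni x=(x_k)_{k\in\mathbb{N}}\mapsto \hat{A}_wx:=w\,\bigl(x_{k+1}+x_1-2l(x)\bigr)_{k\in\mathbb{N}}\in c(\mathbb{N}) \] on the space $c(\mathbb{N})$ is chaotic, as well as its every power \[ c(\mathbb{N})\ni x=(x_k)_{k\in\mathbb{N}}\mapsto \hat{A}_w^nx=w^n\bigl(x_{k+n}+x_n-2l(x)\bigr)_{k\in\mathbb{N}},\quad n\in\mathbb{N}, \] and, provided the underlying space is complex (i.e., $\mathbb{F}=\mathbb{C}$), \[ \sigma(\hat{A}_w)=\{\lambda\in\mathbb{C} : |\lambda|\le|w|\} \] with \[ \sigma_p(\hat{A}_w)=\{\lambda\in\mathbb{C} : |\lambda|<|w|\}\quad\text{and}\quad \sigma_c(\hat{A}_w)=\{\lambda\in\mathbb{C} : |\lambda|=|w|\}. \]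
   Context: $\mathbb{N}=\{1,2,3,\dots\}$, $\mathbb{Z}_+=\{0,1,2,\dots\}$. $c(\mathbb{N})$ is the Banach space of $\mathbb{F}$-valued sequences $x=(x_k)_{k\in\mathbb{N}}$ for which the limit $l(x):=\lim_{k\to\infty}x_k$ exists in $\mathbb{F}$, with the norm $\|x\|_\infty=\sup_{k\in\mathbb{N}}|x_k|$. For a (bounded or unbounded) linear operator $A$ with domain $D(A)$ in a real or complex Banach space $X$, put $A^0:=I$ and $C^\infty(A):=\bigcap_{n=0}^\infty D(A^n)$. A nonzero vector $x\in C^\infty(A)$ is hypercyclic for $A$ if its orbit $\{A^nx\}_{n\in\mathbb{Z}_+}$ is dense in $X$; $A$ is hypercyclic if it possesses a hypercyclic vector. A vector $x\in D(A^N)$ with $A^Nx=x$ for some $N\in\mathbb{N}$ is a periodic point of $A$. $A$ is chaotic if it is hypercyclic and the set of its periodic points is dense in $X$. For a closed linear operator $A$ in a complex Banach space $X$, the spectrum $\sigma(A)$ is the disjoint union of the point spectrum $\sigma_p(A)$ (those $\lambda\in\mathbb{C}$ for which $A-\lambda I$ is not injective), the continuous spectrum $\sigma_c(A)$ (those $\lambda$ for which $A-\lambda I$ is injective, not surjective, and has range dense in $X$), and the residual spectrum $\sigma_r(A)$ (those $\lambda$ for which $A-\lambda I$ is injective and its range is not dense in $X$). *)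

theory Defs
  imports "HOL-Analysis.Analysis"
begin

section \<open>The Banach space of convergent sequences\<close>

text \<open>Sequences are indexed by the positive integers. An element is stored as a function on
  \<^typ>\<open>nat\<close> whose value at the meaningless index \<open>0\<close> is fixed to be \<open>0\<close>, so that two elements
  are equal iff they agree at all indices \<open>k \<ge> 1\<close>.\<close>

typedef (overloaded) ('a::real_normed_field) conv_seq =
  "{x :: nat \<Rightarrow> 'a. x 0 = 0 \<and> convergent x}"
  morphisms cs_nth Abs_conv_seq
  by (rule exI[of _ "\<lambda>_. 0"]) (simp add: convergent_const)

setup_lifting type_definition_conv_seq

lemma cs_nth_0 [simp]: "cs_nth x 0 = 0"
  using cs_nth[of x] by simp

lemma convergent_cs_nth: "convergent (cs_nth x)"
  using cs_nth[of x] by simp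

lemma conv_seq_eqI: "(\<And>k. k \<ge> 1 \<Longrightarrow> cs_nth x k = cs_nth y k) \<Longrightarrow> x = y"
  by (metis cs_nth_0 cs_nth_inject ext less_one linorder_not_le)

definition cs_lim :: "'a::real_normed_field conv_seq \<Rightarrow> 'a" where
  "cs_lim x = lim (cs_nth x)"

lemma tendsto_cs_lim: "cs_nth x \<longlonglongrightarrow> cs_lim x"
  unfolding cs_lim_def using convergent_cs_nth convergent_LIMSEQ_iff by blast

text \<open>Multiplication by scalars of the ground field; for the complex field the library has no
  type class of complex vector spaces.\<close>

lift_definition cs_scale :: "'a::real_normed_field \<Rightarrow> 'a conv_seq \<Rightarrow> 'a conv_seq"
  is "\<lambda>c x k. c * x k"
  by (auto intro!: convergent_mult convergent_const)

instantiation conv_seq :: (real_normed_field) real_vector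
begin

lift_definition zero_conv_seq :: "'a conv_seq" is "\<lambda>_. 0"
  by (simp add: convergent_const)

lift_definition plus_conv_seq :: "'a conv_seq \<Rightarrow> 'a conv_seq \<Rightarrow> 'a conv_seq"
  is "\<lambda>x y k. x k + y k"
  by (auto intro: convergent_add)

lift_definition minus_conv_seq :: "'a conv_seq \<Rightarrow> 'a conv_seq \<Rightarrow> 'a conv_seq"
  is "\<lambda>x y k. x k - y k"
  by (auto intro: convergent_diff)

lift_definition uminus_conv_seq :: "'a conv_seq \<Rightarrow> 'a conv_seq"
  is "\<lambda>x k. - x k"
  by (auto simp flip: convergent_minus_iff)

lift_definition scaleR_conv_seq :: "real \<Rightarrow> 'a conv_seq \<Rightarrow> 'a conv_seq"
  is "\<lambda>r x k. r *\<^sub>R x k"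
  by (auto simp: convergent_def intro: tendsto_scaleR[OF tendsto_const])

instance
  by standard (transfer; auto simp: algebra_simps)+

end

lemma cs_bdd_above: "bdd_above ((\<lambda>k. norm (cs_nth x k)) ` {1..})"
proof -
  have "Bseq (cs_nth x)"
    by (rule convergent_imp_Bseq[OF convergent_cs_nth])
  then obtain K where "\<And>n. norm (cs_nth x n) \<le> K"
    by (auto simp: Bseq_def)
  then show ?thesis
    by (auto intro!: bdd_aboveI[of _ K])
qed

instantiation conv_seq :: (real_normed_field) real_normed_vector
begin

definition norm_conv_seq :: "'a conv_seq \<Rightarrow> real" where
  "norm_conv_seq x = (SUP k\<in>{1..}. norm (cs_nth x k))"

definition dist_conv_seq :: "'a conv_seq \<Rightarrow> 'a conv_seq \<Rightarrow> real" where
  "dist_conv_seq x y = norm (x - y)"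

definition sgn_conv_seq :: "'a conv_seq \<Rightarrow> 'a conv_seq" where
  "sgn_conv_seq x = inverse (norm x) *\<^sub>R x"

definition uniformity_conv_seq :: "('a conv_seq \<times> 'a conv_seq) filter" where
  "uniformity_conv_seq = (INF e\<in>{0 <..}. principal {(x, y). dist x y < e})"

definition open_conv_seq :: "'a conv_seq set \<Rightarrow> bool" where
  "open_conv_seq U = (\<forall>x\<in>U. \<forall>\<^sub>F (x', y) in uniformity. x' = x \<longrightarrow> y \<in> U)"

lemma norm_cs_nth_le_aux: "norm (cs_nth x k) \<le> norm x"
proof (cases "k = 0")
  case False
  then show ?thesis
    unfolding norm_conv_seq_def by (intro cSUP_upper cs_bdd_above) auto
next
  case True
  have "0 \<le> norm (cs_nth x 1)" by simp
  also have "\<dots> \<le> norm x"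
    unfolding norm_conv_seq_def by (intro cSUP_upper cs_bdd_above) auto
  finally show ?thesis using True by simp
qed

lemma norm_conv_seq_le_aux: "(\<And>k. k \<ge> 1 \<Longrightarrow> norm (cs_nth x k) \<le> b) \<Longrightarrow> norm x \<le> b"
  unfolding norm_conv_seq_def by (rule cSUP_least) auto

instance
proof
  fix x y :: "'a conv_seq" and a :: real
  show "norm x = 0 \<longleftrightarrow> x = 0"
  proof
    assume "norm x = 0"
    then have "cs_nth x k = 0" for k
      using norm_cs_nth_le_aux[of x k] by simp
    then show "x = 0"
      by (intro conv_seq_eqI) (simp add: zero_conv_seq.rep_eq)
  next
    assume "x = 0"
    then have "norm x \<le> 0"
      by (intro norm_conv_seq_le_aux) (simp add: zero_conv_seq.rep_eq)
    moreover have "0 \<le> norm x"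
      using norm_cs_nth_le_aux[of x 0] by simp
    ultimately show "norm x = 0" by simp
  qed
  show "norm (x + y) \<le> norm x + norm y"
    by (intro norm_conv_seq_le_aux)
       (auto simp: plus_conv_seq.rep_eq
             intro: norm_triangle_le add_mono norm_cs_nth_le_aux)
  have le: "norm (b *\<^sub>R z) \<le> \<bar>b\<bar> * norm z" for b and z :: "'a conv_seq"
    by (intro norm_conv_seq_le_aux)
       (auto simp: scaleR_conv_seq.rep_eq intro!: mult_left_mono norm_cs_nth_le_aux)
  show "norm (a *\<^sub>R x) = \<bar>a\<bar> * norm x"
  proof (cases "a = 0")
    case True
    then show ?thesis
      using le[of 0 x] norm_cs_nth_le_aux[of "0 *\<^sub>R x" 0] by (simp del: scale_zero_left)
  next
    case False
    have "norm x = norm (inverse a *\<^sub>R (a *\<^sub>R x))"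
      using False by simp
    also have "\<dots> \<le> \<bar>inverse a\<bar> * norm (a *\<^sub>R x)"
      by (rule le)
    finally have "\<bar>a\<bar> * norm x \<le> norm (a *\<^sub>R x)"
      using False by (simp add: field_simps abs_inverse)
    with le[of a x] show ?thesis by simp
  qed
qed (simp_all add: dist_conv_seq_def sgn_conv_seq_def uniformity_conv_seq_def open_conv_seq_def)

end

lemma norm_cs_nth_le: "norm (cs_nth x k) \<le> norm x"
  by (rule norm_cs_nth_le_aux)

lemma norm_conv_seq_le: "(\<And>k. k \<ge> 1 \<Longrightarrow> norm (cs_nth x k) \<le> b) \<Longrightarrow> norm x \<le> b"
  by (rule norm_conv_seq_le_aux)

lemma cs_nth_diff [simp]: "cs_nth (x - y) k = cs_nth x k - cs_nth y k"
  by (simp add: minus_conv_seq.rep_eq)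

instance conv_seq :: ("{real_normed_field, banach}") banach
proof
  fix X :: "nat \<Rightarrow> 'a conv_seq"
  assume X: "Cauchy X"
  have coord: "norm (cs_nth (X m) k - cs_nth (X n) k) \<le> norm (X m - X n)" for m n k
    using norm_cs_nth_le[of "X m - X n" k] by simp
  have "Cauchy (\<lambda>n. cs_nth (X n) k)" for k
    unfolding Cauchy_iff
  proof (intro allI impI)
    fix e :: real assume "e > 0"
    then obtain M where "\<forall>m\<ge>M. \<forall>n\<ge>M. norm (X m - X n) < e"
      using X unfolding Cauchy_iff by blast
    then show "\<exists>M. \<forall>m\<ge>M. \<forall>n\<ge>M. norm (cs_nth (X m) k - cs_nth (X n) k) < e"
      using coord by (meson le_less_trans)
  qed
  then have "\<exists>l. (\<lambda>n. cs_nth (X n) k) \<longlonglongrightarrow> l" for k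
    by (simp add: Cauchy_convergent_iff convergent_def)
  then obtain y where y: "\<And>k. (\<lambda>n. cs_nth (X n) k) \<longlonglongrightarrow> y k"
    by metis
  have unif: "\<exists>M. \<forall>m\<ge>M. \<forall>k. norm (cs_nth (X m) k - y k) \<le> e" if e: "e > 0" for e :: real
  proof -
    obtain M where M: "\<forall>m\<ge>M. \<forall>n\<ge>M. norm (X m - X n) < e"
      using X e unfolding Cauchy_iff by blast
    have "norm (cs_nth (X m) k - y k) \<le> e" if m: "m \<ge> M" for m k
    proof (rule LIMSEQ_le_const2)
      show "(\<lambda>n. norm (cs_nth (X m) k - cs_nth (X n) k)) \<longlonglongrightarrow> norm (cs_nth (X m) k - y k)"
        by (intro tendsto_intros y)
      show "\<exists>N. \<forall>n\<ge>N. norm (cs_nth (X m) k - cs_nth (X n) k) \<le> e"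
        using M m coord by (meson le_less_trans less_imp_le)
    qed
    then show ?thesis by blast
  qed
  have "Cauchy y"
    unfolding Cauchy_iff
  proof (intro allI impI)
    fix e :: real assume e: "e > 0"
    then obtain M where M: "\<And>k. norm (cs_nth (X M) k - y k) \<le> e / 4"
      using unif[of "e / 4"] by auto
    obtain K where K: "\<forall>i\<ge>K. \<forall>j\<ge>K. norm (cs_nth (X M) i - cs_nth (X M) j) < e / 4"
      using convergent_Cauchy[OF convergent_cs_nth[of "X M"]] e unfolding Cauchy_iff
      by (meson divide_pos_pos zero_less_numeral)
    have "norm (y i - y j) < e" if ij: "i \<ge> K" "j \<ge> K" for i j
    proof -
      have "y i - y j = (cs_nth (X M) i - cs_nth (X M) j) - (cs_nth (X M) i - y i)
              + (cs_nth (X M) j - y j)"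
        by simp
      also have "norm \<dots> \<le> norm (cs_nth (X M) i - cs_nth (X M) j) + norm (cs_nth (X M) i - y i)
              + norm (cs_nth (X M) j - y j)"
        by (intro norm_triangle_le add_right_mono norm_triangle_ineq4)
      also have "\<dots> < e"
        using M[of i] M[of j] K[rule_format, OF ij] e by linarith
      finally show ?thesis .
    qed
    then show "\<exists>K. \<forall>i\<ge>K. \<forall>j\<ge>K. norm (y i - y j) < e" by blast
  qed
  then have "convergent y"
    by (rule Cauchy_convergent)
  moreover have "y 0 = 0"
    using y[of 0] by (simp add: LIMSEQ_const_iff)
  ultimately have Y: "cs_nth (Abs_conv_seq y) = y"
    by (simp add: Abs_conv_seq_inverse)
  have "X \<longlonglongrightarrow> Abs_conv_seq y"
    unfolding LIMSEQ_iff
  proof (intro allI impI)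
    fix e :: real assume "e > 0"
    then obtain M where M: "\<forall>m\<ge>M. \<forall>k. norm (cs_nth (X m) k - y k) \<le> e / 2"
      using unif[of "e / 2"] by auto
    have "norm (X m - Abs_conv_seq y) < e" if "m \<ge> M" for m
    proof -
      have "norm (X m - Abs_conv_seq y) \<le> e / 2"
        using M that by (intro norm_conv_seq_le) (simp add: Y)
      then show ?thesis using \<open>e > 0\<close> by simp
    qed
    then show "\<exists>M. \<forall>m\<ge>M. norm (X m - Abs_conv_seq y) < e" by blast
  qed
  then show "convergent X"
    by (auto simp: convergent_def)
qed

lemma vector_space_cs_scale:
  "vector_space (cs_scale :: 'a \<Rightarrow> 'a::real_normed_field conv_seq \<Rightarrow> 'a conv_seq)"
  by unfold_locales (transfer; simp add: fun_eq_iff algebra_simps)+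

lemma cs_scale_of_real: "cs_scale (of_real r) x = r *\<^sub>R x"
  by transfer (simp add: scaleR_conv_of_real)

lemma norm_cs_scale: "norm (cs_scale c x) = norm c * norm x"
proof -
  have le: "norm (cs_scale b z) \<le> norm b * norm z" for b and z :: "'a conv_seq"
    by (intro norm_conv_seq_le)
       (auto simp: cs_scale.rep_eq norm_mult intro!: mult_left_mono norm_cs_nth_le)
  show ?thesis
  proof (cases "c = 0")
    case True
    then show ?thesis
      using le[of 0 x] by simp
  next
    case False
    have "x = cs_scale (inverse c) (cs_scale c x)"
      using False by transfer (simp add: fun_eq_iff)
    then have "norm x \<le> norm (inverse c) * norm (cs_scale c x)"
      using le[of "inverse c" "cs_scale c x"] by simp
    then have "norm c * norm x \<le> norm (cs_scale c x)"
      using False by (simp add: field_simps norm_inverse norm_divide)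
    with le[of c x] show ?thesis by simp
  qed
qed


section \<open>Hypercyclicity and chaos\<close>

text \<open>A (possibly unbounded) operator in \<open>'a\<close> is given by its domain \<open>D\<close> and a function
  \<open>A\<close>, whose values outside \<open>D\<close> are irrelevant.\<close>

primrec power_dom :: "'a::real_normed_vector set \<Rightarrow> ('a \<Rightarrow> 'a) \<Rightarrow> nat \<Rightarrow> 'a set" where
  "power_dom D A 0 = UNIV"
| "power_dom D A (Suc n) = {x \<in> D. A x \<in> power_dom D A n}"

definition C_infinity :: "'a::real_normed_vector set \<Rightarrow> ('a \<Rightarrow> 'a) \<Rightarrow> 'a set" where
  "C_infinity D A = (\<Inter>n. power_dom D A n)"

definition hypercyclic_vector :: "'a::real_normed_vector set \<Rightarrow> ('a \<Rightarrow> 'a) \<Rightarrow> 'a \<Rightarrow> bool" where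
  "hypercyclic_vector D A x \<longleftrightarrow>
     x \<noteq> 0 \<and> x \<in> C_infinity D A \<and> closure {(A ^^ n) x | n. True} = UNIV"

definition hypercyclic :: "'a::real_normed_vector set \<Rightarrow> ('a \<Rightarrow> 'a) \<Rightarrow> bool" where
  "hypercyclic D A \<longleftrightarrow> (\<exists>x. hypercyclic_vector D A x)"

definition periodic_point :: "'a::real_normed_vector set \<Rightarrow> ('a \<Rightarrow> 'a) \<Rightarrow> 'a \<Rightarrow> bool" where
  "periodic_point D A x \<longleftrightarrow> (\<exists>N\<ge>1. x \<in> power_dom D A N \<and> (A ^^ N) x = x)"

definition chaotic :: "'a::real_normed_vector set \<Rightarrow> ('a \<Rightarrow> 'a) \<Rightarrow> bool" where
  "chaotic D A \<longleftrightarrow> hypercyclic D A \<and> closure {x. periodic_point D A x} = UNIV"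


section \<open>Spectrum\<close>

text \<open>The argument \<open>sc\<close> is the multiplication by complex scalars of the underlying space.\<close>

definition point_spectrum ::
  "(complex \<Rightarrow> 'a \<Rightarrow> 'a) \<Rightarrow> 'a::real_normed_vector set \<Rightarrow> ('a \<Rightarrow> 'a) \<Rightarrow> complex set" where
  "point_spectrum sc D A = {z. \<not> inj_on (\<lambda>x. A x - sc z x) D}"

definition continuous_spectrum ::
  "(complex \<Rightarrow> 'a \<Rightarrow> 'a) \<Rightarrow> 'a::real_normed_vector set \<Rightarrow> ('a \<Rightarrow> 'a) \<Rightarrow> complex set" where
  "continuous_spectrum sc D A =
     {z. inj_on (\<lambda>x. A x - sc z x) D \<and>
          (\<lambda>x. A x - sc z x) ` D \<noteq> UNIV \<and>
          closure ((\<lambda>x. A x - sc z x) ` D) = UNIV}"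

definition residual_spectrum ::
  "(complex \<Rightarrow> 'a \<Rightarrow> 'a) \<Rightarrow> 'a::real_normed_vector set \<Rightarrow> ('a \<Rightarrow> 'a) \<Rightarrow> complex set" where
  "residual_spectrum sc D A =
     {z. inj_on (\<lambda>x. A x - sc z x) D \<and>
          closure ((\<lambda>x. A x - sc z x) ` D) \<noteq> UNIV}"

text \<open>For a closed operator in a Banach space the inverse of a bijective \<open>A - \<lambda>I\<close> is
  automatically bounded, hence does not enter the definition.\<close>

definition spectrum ::
  "(complex \<Rightarrow> 'a \<Rightarrow> 'a) \<Rightarrow> 'a::real_normed_vector set \<Rightarrow> ('a \<Rightarrow> 'a) \<Rightarrow> complex set" where
  "spectrum sc D A =
     point_spectrum sc D A \<union> continuous_spectrum sc D A \<union> residual_spectrum sc D A"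

lemma spectrum_iff_not_bij:
  "z \<in> spectrum sc D A \<longleftrightarrow> \<not> bij_betw (\<lambda>x. A x - sc z x) D UNIV"
  by (auto simp: spectrum_def point_spectrum_def continuous_spectrum_def residual_spectrum_def
                 bij_betw_def)

lemma spectrum_parts_disjoint:
  "point_spectrum sc D A \<inter> continuous_spectrum sc D A = {}"
  "point_spectrum sc D A \<inter> residual_spectrum sc D A = {}"
  "continuous_spectrum sc D A \<inter> residual_spectrum sc D A = {}"
  by (auto simp: point_spectrum_def continuous_spectrum_def residual_spectrum_def)


section \<open>The operator\<close>

lift_definition A_hat :: "'a::real_normed_field \<Rightarrow> 'a conv_seq \<Rightarrow> 'a conv_seq"
  is "\<lambda>w x k. if k = 0 then 0 else w * (x (k + 1) + x 1 - 2 * lim x)"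
proof -
  fix w :: 'a and x :: "nat \<Rightarrow> 'a"
  assume "x 0 = 0 \<and> convergent x"
  then obtain l where "x \<longlonglongrightarrow> l"
    by (auto simp: convergent_def)
  then have "(\<lambda>k. x (k + 1)) \<longlonglongrightarrow> l"
    by (rule LIMSEQ_ignore_initial_segment)
  then have "(\<lambda>k. w * (x (k + 1) + x 1 - 2 * lim x)) \<longlonglongrightarrow> w * (l + x 1 - 2 * lim x)"
    by (intro tendsto_intros)
  moreover have "eventually (\<lambda>k. (if k = 0 then 0 else w * (x (k + 1) + x 1 - 2 * lim x))
      = w * (x (k + 1) + x 1 - 2 * lim x)) sequentially"
    by (rule eventually_sequentiallyI[of 1]) simp
  ultimately have "(\<lambda>k. if k = 0 then 0 else w * (x (k + 1) + x 1 - 2 * lim x))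
      \<longlonglongrightarrow> w * (l + x 1 - 2 * lim x)"
    by (simp add: tendsto_cong)
  then show "(if (0::nat) = 0 then 0 else w * (x (0 + 1) + x 1 - 2 * lim x)) = 0 \<and>
      convergent (\<lambda>k. if k = 0 then 0 else w * (x (k + 1) + x 1 - 2 * lim x))"
    by (auto simp: convergent_def)
qed

lemma cs_nth_A_hat:
  "k \<ge> 1 \<Longrightarrow> cs_nth (A_hat w x) k = w * (cs_nth x (k + 1) + cs_nth x 1 - 2 * cs_lim x)"
  by (simp add: A_hat.rep_eq cs_lim_def)

end

theory Submission
  imports Defs
begin

text \<open>The idea is to read a convergent sequence \<open>x\<close> with limit \<open>l\<close> as the null sequence
  \<open>(l, x\<^sub>1 - l, x\<^sub>2 - l, \<dots>)\<close>, here called its null coordinates. This identifies the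
  convergent sequences with the null sequences up to a factor 2 in the norms, and it turns
  \<open>A_hat w\<close> into \<open>w\<close> times the backward shift (\<open>null_coord_A_hat\<close>). Everything stated about
  the odd-looking operator is thus a property of Rolewicz's weighted shift; in particular the
  formula for the powers is read off from \<open>null_coord_A_hat_funpow\<close>.

  Chaos. Take the vectors with finitely many nonzero null coordinates, all of them in a countable
  dense subset of the field: they are dense, countable, and each is annihilated by a power of the
  operator. The forward shift divided by \<open>w\<close> is a right inverse whose iterates decay
  geometrically because \<open>norm w > 1\<close>. From these two facts alone Kitai's criterion produces a
  hypercyclic vector (by the Baire category theorem), and summing the orbit of a vector under a
  high power of the right inverse produces a periodic point near that vector; both arguments pass
  to powers. The field only has to be complete and separable, so that the real and the complex
  case are instances of \<open>chaotic_A_hat_funpow\<close>.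

  Spectrum. Eigenvectors are geometric sequences in null coordinates, which settles injectivity of
  \<open>A_hat w - z\<close>. For its range, the Neumann series \<open>-\<Sum> A\<^sup>n b / z\<^sup>n\<^sup>+\<^sup>1\<close> solves
  \<open>A x - z x = b\<close> whenever it converges: for all \<open>b\<close> if \<open>norm z > norm w\<close>, since
  \<open>A\<^sup>n\<close> has norm at most \<open>4 * norm w ^ n\<close>, and for the dense set above for every
  \<open>z \<noteq> 0\<close>, since the series is then a finite sum. On the circle \<open>norm z = norm w\<close> the
  harmonic series obstructs surjectivity.\<close>

section \<open>Chaos from a right inverse with decaying orbits\<close>

lemma power_dom_UNIV [simp]: "power_dom UNIV A n = UNIV"
  by (induction n) auto

lemma bounded_linear_funpow:
  fixes T :: "'a::real_normed_vector \<Rightarrow> 'a"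
  assumes "bounded_linear T"
  shows "bounded_linear (T ^^ n)"
proof (induction n)
  case 0
  have "T ^^ 0 = (\<lambda>x. x)" by auto
  then show ?case using bounded_linear_ident by metis
next
  case (Suc n)
  then show ?case
    using bounded_linear_compose[OF assms Suc] by (simp add: o_def)
qed

lemma funpow_right_inverse:
  fixes T S :: "'a \<Rightarrow> 'a"
  assumes "\<And>x. T (S x) = x"
  shows "(T ^^ n) ((S ^^ n) x) = x"
proof (induction n)
  case (Suc n)
  have "(T ^^ Suc n) ((S ^^ Suc n) x) = (T ^^ n) (T (S ((S ^^ n) x)))"
    by (simp add: funpow_swap1)
  then show ?case using assms Suc by simp
qed simp

text \<open>Kitai's criterion. For \<open>y\<close> in \<open>D\<close>, the vectors whose orbit comes within a given distance
  of \<open>y\<close> form an open set; it is dense since \<open>x + S\<^sup>n y\<close> is close to \<open>x\<close> while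
  \<open>T\<^sup>n\<close> maps it to \<open>T\<^sup>n x + y\<close>, which is close to \<open>y\<close>, for large \<open>n\<close>.
  Countably many of these sets suffice, and Baire's theorem gives a vector in all of them.\<close>

theorem hypercyclic_criterion:
  fixes T S :: "'a::banach \<Rightarrow> 'a"
  assumes T: "bounded_linear T"
    and D: "countable D" "closure D = UNIV"
    and TS: "\<And>x. T (S x) = x"
    and T0: "\<And>x. x \<in> D \<Longrightarrow> (\<lambda>n. (T ^^ n) x) \<longlonglongrightarrow> 0"
    and S0: "\<And>x. x \<in> D \<Longrightarrow> (\<lambda>n. (S ^^ n) x) \<longlonglongrightarrow> 0"
    and nontrivial: "(u::'a) \<noteq> 0"
  shows "hypercyclic UNIV T"
proof -
  interpret Tn: bounded_linear "T ^^ n" for n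
    by (rule bounded_linear_funpow[OF T])
  define G where "G y m = (\<Union>n. {x. dist ((T ^^ n) x) y < inverse (real (Suc m))})" for y m
  define \<G> where "\<G> = (\<lambda>(y, m). G y m) ` (D \<times> (UNIV::nat set))"
  have G_open: "open (G y m)" for y m
    unfolding G_def
    by (intro open_UN ballI open_Collect_less continuous_intros Tn.continuous_on)
  have G_dense: "closure (G y m) = UNIV" if y: "y \<in> D" for y m
  proof -
    have "x0 \<in> closure (G y m)" for x0
      unfolding closure_approachable
    proof (intro allI impI)
      fix e :: real assume e: "e > 0"
      then have "e / 2 > 0" by simp
      moreover have "x0 \<in> closure D" using D by simp
      ultimately obtain x where x: "x \<in> D" "dist x x0 < e / 2"
        unfolding closure_approachable by blast
      have "\<forall>\<^sub>F n in sequentially. dist ((T ^^ n) x) 0 < inverse (real (Suc m))"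
        by (rule tendstoD[OF T0[OF x(1)]]) simp
      moreover have "\<forall>\<^sub>F n in sequentially. dist ((S ^^ n) y) 0 < e / 2"
        by (rule tendstoD[OF S0[OF y]]) (use e in simp)
      ultimately have "\<forall>\<^sub>F n in sequentially. dist ((T ^^ n) x) 0 < inverse (real (Suc m)) \<and>
          dist ((S ^^ n) y) 0 < e / 2"
        by eventually_elim simp
      then obtain n where n: "norm ((T ^^ n) x) < inverse (real (Suc m))" "norm ((S ^^ n) y) < e / 2"
        unfolding eventually_sequentially dist_norm by auto
      have "(T ^^ n) (x + (S ^^ n) y) = (T ^^ n) x + y"
        by (simp add: Tn.add funpow_right_inverse[of T S, OF TS])
      then have "dist ((T ^^ n) (x + (S ^^ n) y)) y < inverse (real (Suc m))"
        using n(1) by (simp add: dist_norm)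
      then have "x + (S ^^ n) y \<in> G y m"
        unfolding G_def by blast
      moreover have "dist (x + (S ^^ n) y) x0 < e"
      proof -
        have "dist (x + (S ^^ n) y) x0 \<le> norm (x - x0) + norm ((S ^^ n) y)"
          unfolding dist_norm by (metis add_diff_eq add.commute norm_triangle_ineq)
        then show ?thesis using n(2) x(2) by (simp add: dist_norm)
      qed
      ultimately show "\<exists>z\<in>G y m. dist z x0 < e" by blast
    qed
    then show ?thesis by blast
  qed
  have "Met_TC.mcomplete TYPE('a)"
    by (simp add: complete_UNIV)
  then have "Met_TC.mtopology closure_of \<Inter>\<G> = (UNIV :: 'a set)"
  proof (rule Met_TC.metric_Baire_category)
    show "countable \<G>"
      unfolding \<G>_def using D by auto
    show "openin Met_TC.mtopology U \<and> Met_TC.mtopology closure_of U = UNIV" if "U \<in> \<G>" for U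
      using that G_open G_dense by (auto simp: \<G>_def)
  qed
  then have "\<Inter>\<G> \<noteq> {}"
    by (metis UNIV_not_empty closure_of_empty)
  then obtain x where x: "\<And>y m. y \<in> D \<Longrightarrow> x \<in> G y m"
    unfolding \<G>_def by auto
  have dense: "closure {(T ^^ n) x | n. True} = UNIV"
  proof -
    have "z \<in> closure {(T ^^ n) x | n. True}" for z
      unfolding closure_approachable
    proof (intro allI impI)
      fix e :: real assume e: "e > 0"
      then have e2: "e / 2 > 0" by simp
      moreover have "z \<in> closure D" using D by simp
      ultimately obtain y where y: "y \<in> D" "dist y z < e / 2"
        unfolding closure_approachable by blast
      obtain m where m: "inverse (real (Suc m)) < e / 2"
        using reals_Archimedean[OF e2] by blast
      obtain n where "dist ((T ^^ n) x) y < inverse (real (Suc m))"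
        using x[OF y(1), of m] unfolding G_def by blast
      then have "dist ((T ^^ n) x) z < e"
        using m y(2) dist_triangle[of "(T ^^ n) x" z y] by linarith
      then show "\<exists>v\<in>{(T ^^ n) x | n. True}. dist v z < e" by blast
    qed
    then show ?thesis by blast
  qed
  have "x \<noteq> 0"
  proof
    assume "x = 0"
    then have "{(T ^^ n) x | n. True} = {0}" by (auto simp: Tn.zero)
    then show False using dense nontrivial by (auto simp: set_eq_iff)
  qed
  then show ?thesis
    using dense unfolding hypercyclic_def hypercyclic_vector_def C_infinity_def by auto
qed

text \<open>If \<open>T\<^sup>n x = 0\<close>, then \<open>p = x + S\<^sup>n x + S\<^sup>2\<^sup>n x + \<dots>\<close> satisfies \<open>T\<^sup>n p = p\<close>, and the
  distance of \<open>p\<close> from \<open>x\<close> is at most the tail \<open>C x * (q ^ n + q ^ (2 * n) + \<dots>)\<close>, which is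
  small for large \<open>n\<close>.\<close>

theorem dense_periodic_points_criterion:
  fixes T S :: "'a::banach \<Rightarrow> 'a"
  assumes T: "bounded_linear T"
    and D: "closure D = UNIV"
    and TS: "\<And>x. T (S x) = x"
    and T0: "\<And>x. x \<in> D \<Longrightarrow> \<forall>\<^sub>F n in sequentially. (T ^^ n) x = 0"
    and S0: "\<And>x n. x \<in> D \<Longrightarrow> norm ((S ^^ n) x) \<le> C x * q ^ n"
    and q: "0 \<le> q" "q < 1"
  shows "closure {x. periodic_point UNIV T x} = UNIV"
proof -
  have "x \<in> closure {x. periodic_point UNIV T x}" if x: "x \<in> D" for x
    unfolding closure_approachable
  proof (intro allI impI)
    fix e :: real assume e: "e > 0"
    \<comment> \<open>\<open>C x * (q ^ n / (1 - q ^ n))\<close> is the sum of the geometric tail that bounds \<open>p - x\<close>.\<close>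
    have "(\<lambda>n. C x * (q ^ n / (1 - q ^ n))) \<longlonglongrightarrow> C x * (0 / (1 - 0))"
      by (intro tendsto_intros LIMSEQ_power_zero) (use q in auto)
    then have "\<forall>\<^sub>F n in sequentially. C x * (q ^ n / (1 - q ^ n)) < e"
      using e by (auto intro: order_tendstoD)
    then have "\<forall>\<^sub>F n in sequentially. n \<ge> 1 \<and> (T ^^ n) x = 0 \<and> C x * (q ^ n / (1 - q ^ n)) < e"
      using T0[OF x] eventually_ge_at_top[of 1] by eventually_elim simp
    then obtain n where n: "n \<ge> 1" "(T ^^ n) x = 0" "C x * (q ^ n / (1 - q ^ n)) < e"
      unfolding eventually_sequentially by blast
    interpret Tn: bounded_linear "T ^^ n"
      by (rule bounded_linear_funpow[OF T])
    define f where "f k = (S ^^ (k * n)) x" for k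
    have qn: "0 \<le> q ^ n" "q ^ n < 1"
      using q n(1) by (auto simp: power_less_one_iff)
    have f_le: "norm (f k) \<le> C x * (q ^ n) ^ k" for k
      using S0[OF x, of "k * n"] by (simp add: f_def mult.commute flip: power_mult)
    have sums: "(\<lambda>k. C x * (q ^ n) ^ k) sums (C x * (1 / (1 - q ^ n)))"
      by (intro sums_mult geometric_sums) (use qn in simp)
    have summable: "summable f"
      using summable_comparison_test'[OF sums_summable[OF sums], of 0 f] f_le by simp
    have Tf: "(T ^^ n) (f (Suc k)) = f k" for k
      using funpow_right_inverse[of T S n "f k", OF TS] by (simp add: f_def funpow_add)
    have "(T ^^ n) (suminf f) = (\<Sum>k. (T ^^ n) (f k))"
      by (rule Tn.suminf[OF summable])
    also have "\<dots> = (\<Sum>k. (T ^^ n) (f (Suc k)))"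
      using suminf_split_head[OF Tn.summable[OF summable]] n(2) by (simp add: f_def)
    also have "\<dots> = suminf f"
      by (simp add: Tf)
    finally have "periodic_point UNIV T (suminf f)"
      unfolding periodic_point_def using n(1) by auto
    moreover have "dist (suminf f) x < e"
    proof -
      have sums': "(\<lambda>k. C x * q ^ n * (q ^ n) ^ k) sums (C x * q ^ n * (1 / (1 - q ^ n)))"
        by (intro sums_mult geometric_sums) (use qn in simp)
      have "suminf f - x = (\<Sum>k. f (Suc k))"
        using suminf_split_head[OF summable] by (simp add: f_def)
      also have "norm \<dots> \<le> (\<Sum>k. C x * q ^ n * (q ^ n) ^ k)"
        using f_le[of "Suc _"] by (intro norm_suminf_le sums_summable[OF sums']) (simp add: mult.assoc)
      also have "\<dots> = C x * (q ^ n / (1 - q ^ n))"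
        using sums_unique[OF sums'] by simp
      finally show ?thesis using n(3) by (simp add: dist_norm)
    qed
    ultimately show "\<exists>y\<in>{x. periodic_point UNIV T x}. dist y x < e" by blast
  qed
  then have "closure D \<subseteq> closure {x. periodic_point UNIV T x}"
    by (intro closure_minimal) auto
  then show ?thesis using D by auto
qed

lemma periodic_point_funpow:
  assumes "periodic_point UNIV T x"
  shows "periodic_point UNIV (T ^^ n) x"
proof -
  obtain N where N: "N \<ge> 1" "(T ^^ N) x = x"
    using assms by (auto simp: periodic_point_def)
  have "((T ^^ N) ^^ n) x = x"
    using N(2) by (induction n) auto
  then have "((T ^^ n) ^^ N) x = x"
    by (simp add: funpow_mult mult.commute)
  then show ?thesis
    using N(1) by (auto simp: periodic_point_def)
qed

text \<open>Kitai's criterion applies to \<open>T\<^sup>n\<close> and \<open>S\<^sup>n\<close> because their orbits are subsequences of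
  those of \<open>T\<close> and \<open>S\<close>, and every periodic point of \<open>T\<close> is one of \<open>T\<^sup>n\<close>.\<close>

theorem chaotic_funpow_criterion:
  fixes T S :: "'a::banach \<Rightarrow> 'a"
  assumes T: "bounded_linear T"
    and D: "countable D" "closure D = UNIV"
    and TS: "\<And>x. T (S x) = x"
    and T0: "\<And>x. x \<in> D \<Longrightarrow> \<forall>\<^sub>F n in sequentially. (T ^^ n) x = 0"
    and S0: "\<And>x n. x \<in> D \<Longrightarrow> norm ((S ^^ n) x) \<le> C x * q ^ n"
    and q: "0 \<le> q" "q < 1"
    and nontrivial: "(u::'a) \<noteq> 0"
    and n: "n \<ge> 1"
  shows "chaotic UNIV (T ^^ n)"
proof -
  have mono: "filterlim (\<lambda>k. n * k) sequentially sequentially"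
    using n by (intro filterlim_subseq) (auto simp: strict_mono_def)
  have "hypercyclic UNIV (T ^^ n)"
  proof (rule hypercyclic_criterion[where S = "S ^^ n" and D = D])
    show "bounded_linear (T ^^ n)" by (rule bounded_linear_funpow[OF T])
    show "(T ^^ n) ((S ^^ n) x) = x" for x by (rule funpow_right_inverse[of T S, OF TS])
    fix x assume x: "x \<in> D"
    have "(\<lambda>k. (T ^^ k) x) \<longlonglongrightarrow> 0"
      by (rule tendsto_eventually[OF T0[OF x]])
    from filterlim_compose[OF this mono] show "(\<lambda>k. ((T ^^ n) ^^ k) x) \<longlonglongrightarrow> 0"
      by (simp add: funpow_mult mult.commute)
    have "(\<lambda>k. C x * q ^ k) \<longlonglongrightarrow> 0"
      using q by (intro tendsto_mult_right_zero LIMSEQ_power_zero) auto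
    then have "(\<lambda>k. (S ^^ k) x) \<longlonglongrightarrow> 0"
      by (rule Lim_null_comparison[rotated]) (simp add: S0[OF x])
    from filterlim_compose[OF this mono] show "(\<lambda>k. ((S ^^ n) ^^ k) x) \<longlonglongrightarrow> 0"
      by (simp add: funpow_mult mult.commute)
  qed (use D nontrivial in auto)
  moreover have "closure {x. periodic_point UNIV (T ^^ n) x} = UNIV"
  proof -
    have "{x. periodic_point UNIV T x} \<subseteq> {x. periodic_point UNIV (T ^^ n) x}"
      using periodic_point_funpow by blast
    from closure_mono[OF this] show ?thesis
      using dense_periodic_points_criterion[OF T D(2) TS T0 S0 q] by auto
  qed
  ultimately show ?thesis by (simp add: chaotic_def)
qed

section \<open>Coordinates identifying the space with the null sequences\<close>

text \<open>The null sequence \<open>(l, x\<^sub>1 - l, x\<^sub>2 - l, \<dots>)\<close>. The otherwise meaningless index \<open>0\<close>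
  carries the limit \<open>l\<close>, so that the shift in \<open>null_coord_A_hat\<close> holds at all indices
  alike.\<close>

definition null_coord :: "'a::real_normed_field conv_seq \<Rightarrow> nat \<Rightarrow> 'a" where
  "null_coord x k = (if k = 0 then cs_lim x else cs_nth x k - cs_lim x)"

definition of_null_coord :: "(nat \<Rightarrow> 'a) \<Rightarrow> 'a::real_normed_field conv_seq" where
  "of_null_coord y = Abs_conv_seq (\<lambda>k. if k = 0 then 0 else y k + y 0)"

lemma cs_lim_eqI: "cs_nth x \<longlonglongrightarrow> l \<Longrightarrow> cs_lim x = l"
  using LIMSEQ_unique tendsto_cs_lim by blast

text \<open>Explicit formulas for sequence entries hold only from index 1 on; the limit ignores the
  value at \<open>0\<close>.\<close>

lemma cs_lim_eqI_from_1:
  assumes "f \<longlonglongrightarrow> l" "\<And>k. k \<ge> 1 \<Longrightarrow> cs_nth x k = f k"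
  shows "cs_lim x = l"
proof (rule cs_lim_eqI)
  have "\<forall>\<^sub>F k in sequentially. cs_nth x k = f k"
    using assms(2) by (auto simp: eventually_sequentially)
  then show "cs_nth x \<longlonglongrightarrow> l"
    using assms(1) by (simp add: tendsto_cong)
qed

lemma cs_nth_conv_null_coord: "k \<ge> 1 \<Longrightarrow> cs_nth x k = null_coord x k + null_coord x 0"
  by (simp add: null_coord_def)

lemma null_coord_inject: "null_coord x = null_coord y \<Longrightarrow> x = y"
  by (rule conv_seq_eqI) (simp add: cs_nth_conv_null_coord)

lemma null_coord_tendsto: "null_coord x \<longlonglongrightarrow> 0"
proof -
  have "(\<lambda>k. cs_nth x k - cs_lim x) \<longlonglongrightarrow> cs_lim x - cs_lim x"
    by (intro tendsto_intros tendsto_cs_lim)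
  moreover have "\<forall>\<^sub>F k in sequentially. null_coord x k = cs_nth x k - cs_lim x"
    by (auto simp: eventually_sequentially null_coord_def intro!: exI[of _ 1])
  ultimately show ?thesis by (simp add: tendsto_cong)
qed

lemma null_coord_of_null_coord:
  assumes "y \<longlonglongrightarrow> 0"
  shows "null_coord (of_null_coord y) = y"
proof -
  have lim: "(\<lambda>k. y k + y 0) \<longlonglongrightarrow> y 0"
    using tendsto_add[OF assms tendsto_const[of "y 0"]] by simp
  have "\<forall>\<^sub>F k in sequentially. (if k = 0 then 0 else y k + y 0) = y k + y 0"
    by (auto simp: eventually_sequentially intro!: exI[of _ 1])
  then have "(\<lambda>k. if k = 0 then 0 else y k + y 0) \<longlonglongrightarrow> y 0"
    using lim by (simp add: tendsto_cong)
  then have nth: "cs_nth (of_null_coord y) = (\<lambda>k. if k = 0 then 0 else y k + y 0)"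
    unfolding of_null_coord_def by (subst Abs_conv_seq_inverse) (auto simp: convergent_def)
  have "cs_lim (of_null_coord y) = y 0"
    by (rule cs_lim_eqI_from_1[OF lim]) (simp add: nth)
  then show ?thesis
    by (auto simp: null_coord_def nth)
qed

lemma cs_lim_add: "cs_lim (x + y) = cs_lim x + cs_lim y"
  by (rule cs_lim_eqI_from_1[OF tendsto_add[OF tendsto_cs_lim tendsto_cs_lim]])
     (simp add: plus_conv_seq.rep_eq)

lemma cs_lim_scale: "cs_lim (cs_scale c x) = c * cs_lim x"
  by (rule cs_lim_eqI_from_1[OF tendsto_mult[OF tendsto_const tendsto_cs_lim]])
     (simp add: cs_scale.rep_eq)

lemma null_coord_add: "null_coord (x + y) k = null_coord x k + null_coord y k"
  by (simp add: null_coord_def cs_lim_add plus_conv_seq.rep_eq)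

lemma null_coord_scale: "null_coord (cs_scale c x) k = c * null_coord x k"
  by (simp add: null_coord_def cs_lim_scale cs_scale.rep_eq algebra_simps)

lemma null_coord_diff: "null_coord (x - y) k = null_coord x k - null_coord y k"
  using null_coord_add[of "x - y" y k] by simp

lemma null_coord_0 [simp]: "null_coord 0 k = 0"
  using null_coord_diff[of 0 0 k] by simp

lemma norm_cs_lim_le: "norm (cs_lim x) \<le> norm x"
  by (rule LIMSEQ_le_const2[OF tendsto_norm[OF tendsto_cs_lim[of x]]]) (auto intro: norm_cs_nth_le)

lemma norm_null_coord_le: "norm (null_coord x k) \<le> 2 * norm x"
proof (cases "k = 0")
  case True
  then show ?thesis
    using norm_cs_lim_le[of x] order_trans[of "norm (cs_lim x)" "norm x" "2 * norm x"]
    by (simp add: null_coord_def)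
next
  case False
  have "norm (null_coord x k) \<le> norm (cs_nth x k) + norm (cs_lim x)"
    using False by (simp add: null_coord_def norm_triangle_ineq4)
  then show ?thesis
    using norm_cs_lim_le[of x] norm_cs_nth_le[of x k] by linarith
qed

lemma norm_le_null_coord:
  assumes "\<And>k. norm (null_coord x k) \<le> b"
  shows "norm x \<le> 2 * b"
proof (rule norm_conv_seq_le)
  fix k :: nat assume "k \<ge> 1"
  then have "norm (cs_nth x k) \<le> norm (null_coord x k) + norm (null_coord x 0)"
    by (simp add: cs_nth_conv_null_coord norm_triangle_ineq)
  then show "norm (cs_nth x k) \<le> 2 * b"
    using assms[of k] assms[of 0] by linarith
qed

text \<open>Truncating the null coordinates of a vector changes it little because they tend to \<open>0\<close>;
  the remaining ones are then moved into a countable dense subset of the field.\<close>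

lemma countable_dense_finite_null_coord:
  obtains D :: "'a::{real_normed_field, second_countable_topology} conv_seq set"
  where "countable D" "closure D = UNIV" "\<forall>x\<in>D. \<exists>N. \<forall>k\<ge>N. null_coord x k = 0"
proof -
  obtain Q :: "'a set" where Q: "countable Q" "\<And>X. open X \<Longrightarrow> X \<noteq> {} \<Longrightarrow> \<exists>d\<in>Q. d \<in> X"
    using countable_dense_setE by metis
  define v :: "'a list \<Rightarrow> nat \<Rightarrow> 'a" where "v l k = (if k < length l then l ! k else 0)" for l k
  have v0: "v l \<longlonglongrightarrow> 0" for l
    by (rule tendsto_eventually) (auto simp: v_def eventually_sequentially intro!: exI[of _ "length l"])
  define D where "D = (\<lambda>l. of_null_coord (v l)) ` lists Q"
  show thesis
  proof
    show "countable D"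
      unfolding D_def using Q(1) by simp
    show "\<forall>x\<in>D. \<exists>N. \<forall>k\<ge>N. null_coord x k = 0"
    proof
      fix x assume "x \<in> D"
      then obtain l where "x = of_null_coord (v l)" by (auto simp: D_def)
      then have "\<forall>k\<ge>length l. null_coord x k = 0"
        by (simp add: null_coord_of_null_coord[OF v0] v_def)
      then show "\<exists>N. \<forall>k\<ge>N. null_coord x k = 0" by blast
    qed
    have "x \<in> closure D" for x
      unfolding closure_approachable
    proof (intro allI impI)
      fix e :: real assume e: "e > 0"
      then have e3: "e / 3 > 0" by simp
      obtain K where K: "\<And>k. k \<ge> K \<Longrightarrow> norm (null_coord x k) < e / 3"
        using LIMSEQ_D[OF null_coord_tendsto[of x] e3] by auto
      have "\<exists>d\<in>Q. d \<in> ball (null_coord x k) (e / 3)" for k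
        using e3 by (intro Q(2)) auto
      then obtain q where q: "\<And>k. q k \<in> Q" "\<And>k. dist (null_coord x k) (q k) < e / 3"
        by (metis mem_ball)
      let ?d = "of_null_coord (v (map q [0..<K]))"
      have "?d \<in> D"
        unfolding D_def using q(1) by (intro imageI) auto
      moreover have "norm (?d - x) \<le> 2 * (e / 3)"
      proof (rule norm_le_null_coord)
        show "norm (null_coord (?d - x) k) \<le> e / 3" for k
          using K[of k] q(2)[of k]
          by (auto simp: null_coord_diff null_coord_of_null_coord[OF v0] v_def dist_norm
                norm_minus_commute)
      qed
      ultimately show "\<exists>y\<in>D. dist y x < e"
        using e by (intro bexI[of _ ?d]) (auto simp: dist_norm)
    qed
    then show "closure D = UNIV" by blast
  qed
qed

section \<open>The operator as a weighted backward shift\<close>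

lemma cs_lim_A_hat: "cs_lim (A_hat w x) = w * (cs_nth x 1 - cs_lim x)"
proof (rule cs_lim_eqI_from_1[OF _ cs_nth_A_hat])
  have "(\<lambda>k. cs_nth x (k + 1)) \<longlonglongrightarrow> cs_lim x"
    by (rule LIMSEQ_ignore_initial_segment[OF tendsto_cs_lim])
  then have "(\<lambda>k. w * (cs_nth x (k + 1) + cs_nth x 1 - 2 * cs_lim x))
      \<longlonglongrightarrow> w * (cs_lim x + cs_nth x 1 - 2 * cs_lim x)"
    by (intro tendsto_intros)
  then show "(\<lambda>k. w * (cs_nth x (k + 1) + cs_nth x 1 - 2 * cs_lim x))
      \<longlonglongrightarrow> w * (cs_nth x 1 - cs_lim x)"
    by (simp add: algebra_simps)
qed simp

text \<open>The key identity: \<open>cs_lim (A_hat w x) = w * (x\<^sub>1 - l)\<close> gives index \<open>0\<close>, and subtracting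
  this limit from the entries \<open>w * (x\<^sub>k\<^sub>+\<^sub>1 + x\<^sub>1 - 2 * l)\<close> leaves \<open>w * (x\<^sub>k\<^sub>+\<^sub>1 - l)\<close>.\<close>

lemma null_coord_A_hat: "null_coord (A_hat w x) k = w * null_coord x (Suc k)"
  by (simp add: null_coord_def cs_lim_A_hat cs_nth_A_hat algebra_simps)

lemma null_coord_A_hat_funpow: "null_coord ((A_hat w ^^ n) x) k = w ^ n * null_coord x (k + n)"
  by (induction n arbitrary: k) (simp_all add: null_coord_A_hat)

lemma cs_nth_A_hat_funpow:
  assumes "n \<ge> 1" "k \<ge> 1"
  shows "cs_nth ((A_hat w ^^ n) x) k = w ^ n * (cs_nth x (k + n) + cs_nth x n - 2 * cs_lim x)"
  using assms
  by (simp add: cs_nth_conv_null_coord[of k] null_coord_A_hat_funpow) 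
     (simp add: null_coord_def algebra_simps)

lemma A_hat_add: "A_hat w (x + y) = A_hat w x + A_hat w y"
  by (rule null_coord_inject) (simp add: fun_eq_iff null_coord_A_hat null_coord_add algebra_simps)

lemma A_hat_scale: "A_hat w (cs_scale c x) = cs_scale c (A_hat w x)"
  by (rule null_coord_inject) (simp add: fun_eq_iff null_coord_A_hat null_coord_scale algebra_simps)

lemma linear_A_hat: "Vector_Spaces.linear cs_scale cs_scale (A_hat w)"
proof -
  interpret vector_space "cs_scale :: 'a \<Rightarrow> 'a conv_seq \<Rightarrow> 'a conv_seq"
    by (rule vector_space_cs_scale)
  show ?thesis
    by unfold_locales (rule A_hat_add A_hat_scale)+
qed

lemma norm_A_hat_funpow_le: "norm ((A_hat w ^^ n) x) \<le> 4 * norm w ^ n * norm x"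
proof -
  have "norm ((A_hat w ^^ n) x) \<le> 2 * (norm w ^ n * (2 * norm x))"
    by (rule norm_le_null_coord)
       (auto simp: null_coord_A_hat_funpow norm_mult norm_power
          intro!: mult_left_mono norm_null_coord_le)
  then show ?thesis by simp
qed

lemma bounded_linear_A_hat: "bounded_linear (A_hat w)"
proof (rule bounded_linear_intro)
  show "A_hat w (x + y) = A_hat w x + A_hat w y" for x y by (rule A_hat_add)
  show "A_hat w (r *\<^sub>R x) = r *\<^sub>R A_hat w x" for r x
    using A_hat_scale[of w "of_real r" x] by (simp add: cs_scale_of_real)
  show "norm (A_hat w x) \<le> norm x * (4 * norm w)" for x
    using norm_A_hat_funpow_le[where n = 1 and w = w and x = x] by (simp add: mult_ac)
qed

definition scaled_shift :: "'a::real_normed_field \<Rightarrow> 'a conv_seq \<Rightarrow> 'a conv_seq" where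
  "scaled_shift w x = of_null_coord (case_nat 0 (\<lambda>k. null_coord x k / w))"

lemma null_coord_scaled_shift:
  "null_coord (scaled_shift w x) = case_nat 0 (\<lambda>k. null_coord x k / w)"
  unfolding scaled_shift_def
proof (rule null_coord_of_null_coord)
  have "(\<lambda>k. null_coord x k / w) \<longlonglongrightarrow> 0"
    using tendsto_mult_left_zero[OF null_coord_tendsto[of x], of "inverse w"]
    by (simp add: divide_inverse)
  then show "case_nat 0 (\<lambda>k. null_coord x k / w) \<longlonglongrightarrow> 0"
    by (subst filterlim_sequentially_Suc[symmetric]) simp
qed

lemma A_hat_scaled_shift: "w \<noteq> 0 \<Longrightarrow> A_hat w (scaled_shift w x) = x"
  by (rule null_coord_inject) (simp add: fun_eq_iff null_coord_A_hat null_coord_scaled_shift)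

lemma null_coord_scaled_shift_funpow:
  "null_coord ((scaled_shift w ^^ n) x) k = (if k < n then 0 else null_coord x (k - n) / w ^ n)"
  by (induction n arbitrary: k)
     (auto simp: null_coord_scaled_shift divide_simps split: nat.split)

lemma norm_scaled_shift_funpow_le:
  "norm ((scaled_shift w ^^ n) x) \<le> 4 * norm x * inverse (norm w) ^ n"
proof -
  have "norm ((scaled_shift w ^^ n) x) \<le> 2 * (2 * norm x / norm w ^ n)"
    by (rule norm_le_null_coord)
       (auto simp: null_coord_scaled_shift_funpow norm_divide norm_power
          intro!: divide_right_mono norm_null_coord_le)
  then show ?thesis by (simp add: divide_inverse power_inverse)
qed

lemma A_hat_nilpotent_on_finite:
  assumes "\<forall>k\<ge>N. null_coord x k = 0" "n \<ge> N"
  shows "(A_hat w ^^ n) x = 0"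
  by (rule null_coord_inject) (use assms in \<open>simp add: fun_eq_iff null_coord_A_hat_funpow\<close>)

text \<open>The geometric ratio in \<open>chaotic_funpow_criterion\<close> is \<open>1 / norm w\<close>, and this is where
  \<open>norm w > 1\<close> enters.\<close>

theorem chaotic_A_hat_funpow:
  fixes w :: "'a::{real_normed_field, banach, second_countable_topology}"
  assumes w: "norm w > 1" and n: "n \<ge> 1"
  shows "chaotic UNIV (A_hat w ^^ n)"
proof -
  obtain D :: "'a conv_seq set" where D: "countable D" "closure D = UNIV"
      "\<forall>x\<in>D. \<exists>N. \<forall>k\<ge>N. null_coord x k = 0"
    by (rule countable_dense_finite_null_coord)
  \<comment> \<open>A unit vector shows that the space is not trivial.\<close>
  have "(\<lambda>k. if k = 0 then 1 else 0 :: 'a) \<longlonglongrightarrow> 0"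
    by (rule tendsto_eventually) (auto simp: eventually_sequentially intro!: exI[of _ 1])
  from null_coord_of_null_coord[OF this]
  have u: "of_null_coord (\<lambda>k. if k = 0 then 1 else 0 :: 'a) \<noteq> 0"
    by (metis null_coord_0 zero_neq_one)
  show ?thesis
  proof (rule chaotic_funpow_criterion[OF bounded_linear_A_hat D(1,2) _ _ _ _ _ u n])
    show "A_hat w (scaled_shift w x) = x" for x
      using w by (intro A_hat_scaled_shift) auto
    show "\<forall>\<^sub>F n in sequentially. (A_hat w ^^ n) x = 0" if "x \<in> D" for x
      using D(3) that A_hat_nilpotent_on_finite unfolding eventually_sequentially by blast
    show "norm ((scaled_shift w ^^ n) x) \<le> 4 * norm x * inverse (norm w) ^ n" for x n
      by (rule norm_scaled_shift_funpow_le)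
    show "0 \<le> inverse (norm w)" "inverse (norm w) < 1"
      using w by (auto simp: inverse_less_1_iff)
  qed
qed

corollary chaotic_A_hat:
  fixes w :: "'a::{real_normed_field, banach, second_countable_topology}"
  assumes "norm w > 1"
  shows "chaotic UNIV (A_hat w)"
  using chaotic_A_hat_funpow[OF assms, of 1] by simp

section \<open>The spectrum\<close>

text \<open>In null coordinates an eigenvector for \<open>z\<close> has to be a geometric sequence of ratio
  \<open>z / w\<close>, and this is a null sequence exactly for \<open>norm z < norm w\<close>.\<close>

lemma inj_A_hat_minus_scale_iff:
  assumes w: "w \<noteq> 0"
  shows "inj (\<lambda>x. A_hat w x - cs_scale z x) \<longleftrightarrow> norm w \<le> norm z"
proof
  assume inj: "inj (\<lambda>x. A_hat w x - cs_scale z x)"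
  show "norm w \<le> norm z"
  proof (rule ccontr)
    assume "\<not> norm w \<le> norm z"
    then have "(\<lambda>k. (z / w) ^ k) \<longlonglongrightarrow> 0"
      using w by (intro LIMSEQ_power_zero) (simp add: norm_divide)
    note y = null_coord_of_null_coord[OF this]
    let ?x = "of_null_coord (\<lambda>k. (z / w) ^ k)"
    have "A_hat w ?x - cs_scale z ?x = A_hat w 0 - cs_scale z 0"
      by (rule null_coord_inject)
         (use w in \<open>simp add: fun_eq_iff null_coord_diff null_coord_A_hat null_coord_scale y\<close>)
    then have "?x = 0"
      by (rule injD[OF inj])
    then show False
      by (metis y null_coord_0 power_0 zero_neq_one)
  qed
next
  assume z: "norm w \<le> norm z"
  show "inj (\<lambda>x. A_hat w x - cs_scale z x)"
  proof (rule injI)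
    fix x x' assume eq: "A_hat w x - cs_scale z x = A_hat w x' - cs_scale z x'"
    define y where "y = null_coord (x - x')"
    have rec: "w * y (Suc k) = z * y k" for k
      using arg_cong[OF eq, of "\<lambda>v. null_coord v k"] unfolding y_def
      by (simp add: null_coord_diff null_coord_A_hat null_coord_scale algebra_simps)
    have "norm (y k) \<le> norm (y (Suc k))" for k
    proof -
      have "norm w * norm (y k) \<le> norm z * norm (y k)"
        using z by (intro mult_right_mono) auto
      also have "\<dots> = norm w * norm (y (Suc k))"
        using rec[of k] by (metis norm_mult)
      finally show ?thesis using w by simp
    qed
    then have "incseq (\<lambda>k. norm (y k))"
      by (rule incseq_SucI)
    moreover have "(\<lambda>k. norm (y k)) \<longlonglongrightarrow> 0"
      unfolding y_def by (rule tendsto_norm_zero[OF null_coord_tendsto])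
    ultimately have "norm (y k) \<le> 0" for k
      using incseq_le by blast
    then have "null_coord (x - x') = null_coord 0"
      by (simp add: fun_eq_iff y_def)
    then show "x = x'"
      using null_coord_inject by (metis eq_iff_diff_eq_0)
  qed
qed

lemma bounded_linear_cs_scale: "bounded_linear (cs_scale c)"
proof (rule bounded_linear_intro)
  show "cs_scale c (x + y) = cs_scale c x + cs_scale c y" for x y
    by (rule null_coord_inject) (simp add: fun_eq_iff null_coord_add null_coord_scale algebra_simps)
  show "cs_scale c (r *\<^sub>R x) = r *\<^sub>R cs_scale c x" for r x
    by (rule null_coord_inject)
       (simp add: fun_eq_iff null_coord_scale flip: cs_scale_of_real)
  show "norm (cs_scale c x) \<le> norm x * norm c" for x
    by (simp add: norm_cs_scale mult.commute)
qed

lemma cs_scale_zero_right [simp]: "cs_scale c 0 = 0"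
  by (rule null_coord_inject) (simp add: fun_eq_iff null_coord_scale)

text \<open>With \<open>f\<^sub>n = A\<^sup>n b / z\<^sup>n\<^sup>+\<^sup>1\<close> one has \<open>A f\<^sub>n = z f\<^sub>n\<^sub>+\<^sub>1\<close>, so that \<open>A - z\<close> applied to
  the sum of the series telescopes to \<open>- z f\<^sub>0 = - b\<close>.\<close>

lemma Neumann_series_in_range:
  assumes z: "z \<noteq> 0"
    and summable: "summable (\<lambda>n. cs_scale (inverse z ^ Suc n) ((A_hat w ^^ n) b))"
  shows "b \<in> range (\<lambda>x. A_hat w x - cs_scale z x)"
proof -
  define f where "f n = cs_scale (inverse z ^ Suc n) ((A_hat w ^^ n) b)" for n
  have f: "summable f" using summable by (simp add: f_def[abs_def])
  interpret B: bounded_linear "\<lambda>x. A_hat w x - cs_scale z x"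
    by (rule bounded_linear_sub[OF bounded_linear_A_hat bounded_linear_cs_scale])
  have zf: "cs_scale z (f 0) = b"
    by (rule null_coord_inject) (use z in \<open>simp add: f_def fun_eq_iff null_coord_scale\<close>)
  have step: "A_hat w (f n) - cs_scale z (f n) = cs_scale z (f (Suc n)) - cs_scale z (f n)" for n
    by (rule null_coord_inject)
       (use z in \<open>simp add: f_def A_hat_scale fun_eq_iff null_coord_scale null_coord_diff\<close>)
  have "(\<lambda>n. A_hat w (f n) - cs_scale z (f n)) sums (A_hat w (suminf f) - cs_scale z (suminf f))"
    by (rule B.sums[OF summable_sums[OF f]])
  moreover have "(\<lambda>n. cs_scale z (f (Suc n)) - cs_scale z (f n)) sums (cs_scale z 0 - cs_scale z (f 0))"
    by (rule telescope_sums)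
       (rule bounded_linear.tendsto[OF bounded_linear_cs_scale summable_LIMSEQ_zero[OF f]])
  ultimately have "A_hat w (suminf f) - cs_scale z (suminf f) = cs_scale z 0 - cs_scale z (f 0)"
    by (simp add: step sums_iff)
  then have "A_hat w (- suminf f) - cs_scale z (- suminf f) = b"
    by (simp add: B.neg zf)
  then show ?thesis by (rule range_eqI[OF sym])
qed

lemma A_hat_minus_scale_surj:
  fixes w :: "'a::{real_normed_field, banach}"
  assumes "norm w < norm z"
  shows "range (\<lambda>x. A_hat w x - cs_scale z x) = UNIV"
proof -
  have z: "z \<noteq> 0" using assms by auto
  have "b \<in> range (\<lambda>x. A_hat w x - cs_scale z x)" for b
  proof (rule Neumann_series_in_range[OF z], rule summable_comparison_test')
    have "(norm w / norm z) < 1" using assms z by simp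
    then show "summable (\<lambda>n. 4 * norm b / norm z * (norm w / norm z) ^ n)"
      by (intro summable_mult summable_geometric) simp
    fix n
    have "norm (cs_scale (inverse z ^ Suc n) ((A_hat w ^^ n) b))
        = inverse (norm z) ^ Suc n * norm ((A_hat w ^^ n) b)"
      by (simp add: norm_cs_scale norm_mult norm_power norm_inverse)
    also have "\<dots> \<le> inverse (norm z) ^ Suc n * (4 * norm w ^ n * norm b)"
      by (intro mult_left_mono norm_A_hat_funpow_le) simp
    also have "\<dots> = 4 * norm b / norm z * (norm w / norm z) ^ n"
      by (simp add: divide_inverse power_mult_distrib power_inverse)
    finally show "norm (cs_scale (inverse z ^ Suc n) ((A_hat w ^^ n) b))
        \<le> 4 * norm b / norm z * (norm w / norm z) ^ n" .
  qed
  then show ?thesis by blast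
qed

text \<open>On vectors with finitely many nonzero null coordinates the Neumann series breaks off, whatever
  the size of \<open>z\<close>.\<close>

lemma A_hat_minus_scale_dense_range:
  fixes w :: "'a::{real_normed_field, second_countable_topology}"
  assumes z: "z \<noteq> 0"
  shows "closure (range (\<lambda>x. A_hat w x - cs_scale z x)) = UNIV"
proof -
  obtain D :: "'a conv_seq set" where D: "countable D" "closure D = UNIV"
      "\<forall>x\<in>D. \<exists>N. \<forall>k\<ge>N. null_coord x k = 0"
    by (rule countable_dense_finite_null_coord)
  have "D \<subseteq> range (\<lambda>x. A_hat w x - cs_scale z x)"
  proof
    fix b assume "b \<in> D"
    then obtain N where N: "\<forall>k\<ge>N. null_coord b k = 0" using D(3) by blast
    show "b \<in> range (\<lambda>x. A_hat w x - cs_scale z x)"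
    proof (rule Neumann_series_in_range[OF z], rule summable_finite)
      show "cs_scale (inverse z ^ Suc n) ((A_hat w ^^ n) b) = 0" if "n \<notin> {..<N}" for n
        using A_hat_nilpotent_on_finite[OF N, of n w] that by simp
    qed simp
  qed
  from closure_mono[OF this] show ?thesis using D(2) by auto
qed

text \<open>Put \<open>r = z / w\<close>, which has norm 1. In null coordinates, dividing a solution of
  \<open>A x - z x = b\<close> by \<open>r ^ k\<close> turns the equation into \<open>u\<^sub>k\<^sub>+\<^sub>1 - u\<^sub>k = b\<^sub>k / (z * r ^ k)\<close>,
  and \<open>u\<close> is still a null sequence. The null sequence \<open>b\<close> chosen below makes the increments
  of \<open>u\<close> the terms \<open>1 / (k + 1)\<close>, whose sum diverges.\<close>

lemma A_hat_minus_scale_not_surj: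
  fixes w :: "'a::{real_normed_field, banach}"
  assumes w: "w \<noteq> 0" and z: "norm z = norm w"
  shows "range (\<lambda>x. A_hat w x - cs_scale z x) \<noteq> UNIV"
proof
  assume surj: "range (\<lambda>x. A_hat w x - cs_scale z x) = UNIV"
  define r where "r = z / w"
  have z0: "z \<noteq> 0" using z w by auto
  have r: "norm r = 1" and r0: "r \<noteq> 0" and zr: "z = w * r"
    using z w z0 by (auto simp: r_def norm_divide)
  let ?b = "\<lambda>k. z * r ^ k * inverse (of_nat (Suc k))"
  have b: "?b \<longlonglongrightarrow> 0"
  proof (rule tendsto_norm_zero_cancel)
    have "(\<lambda>k. norm z * inverse (real (Suc k))) \<longlonglongrightarrow> 0"
      by (intro tendsto_mult_right_zero LIMSEQ_inverse_real_of_nat)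
    then show "(\<lambda>k. norm (?b k)) \<longlonglongrightarrow> 0"
      by (simp add: norm_mult norm_power norm_inverse r del: of_nat_Suc)
  qed
  have "of_null_coord ?b \<in> range (\<lambda>x. A_hat w x - cs_scale z x)"
    unfolding surj by (rule UNIV_I)
  then obtain x where x: "of_null_coord ?b = A_hat w x - cs_scale z x"
    by (rule rangeE)
  have rec: "w * null_coord x (Suc k) - z * null_coord x k = ?b k" for k
    using arg_cong[OF x, of "\<lambda>v. null_coord v k"] unfolding null_coord_of_null_coord[OF b]
    by (simp add: null_coord_diff null_coord_A_hat null_coord_scale
          del: of_nat_Suc)
  define u where "u k = null_coord x k / r ^ k" for k
  have step: "u (Suc k) - u k = inverse (of_nat (Suc k))" for k
  proof -
    have "z * r ^ k * (u (Suc k) - u k) = w * null_coord x (Suc k) - z * null_coord x k"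
      using r0 by (simp add: u_def zr field_simps)
    with rec[of k] have "(z * r ^ k) * (u (Suc k) - u k) = (z * r ^ k) * inverse (of_nat (Suc k))"
      by simp
    then show ?thesis using z0 r0 by (simp del: of_nat_Suc)
  qed
  have "u \<longlonglongrightarrow> 0"
  proof (rule tendsto_norm_zero_cancel)
    show "(\<lambda>k. norm (u k)) \<longlonglongrightarrow> 0"
      using tendsto_norm_zero[OF null_coord_tendsto[of x]]
      by (simp add: u_def norm_divide norm_power r)
  qed
  from telescope_sums[OF this] have "summable (\<lambda>k. inverse (of_nat (Suc k)) :: 'a)"
    unfolding step by (rule sums_summable)
  then have "summable (\<lambda>k. inverse (of_nat k) :: 'a)"
    by (subst (asm) summable_Suc_iff)
  then show False using not_summable_harmonic by blast
qed

lemma point_spectrum_A_hat: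
  assumes "w \<noteq> 0"
  shows "point_spectrum cs_scale UNIV (A_hat w) = {z. norm z < norm w}"
  unfolding point_spectrum_def inj_A_hat_minus_scale_iff[OF assms] not_le ..

theorem continuous_spectrum_A_hat:
  assumes w: "w \<noteq> 0"
  shows "continuous_spectrum cs_scale UNIV (A_hat w) = {z. norm z = norm w}"
proof -
  have "z \<in> continuous_spectrum cs_scale UNIV (A_hat w) \<longleftrightarrow> norm z = norm w" for z
  proof (cases "norm w \<le> norm z")
    case True
    then have "z \<noteq> 0" using w by auto
    moreover have "range (\<lambda>x. A_hat w x - cs_scale z x) = UNIV \<longleftrightarrow> norm z \<noteq> norm w"
      using True A_hat_minus_scale_surj[of w z] A_hat_minus_scale_not_surj[OF w, of z] by linarith
    ultimately show ?thesis
      using True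
      by (simp add: continuous_spectrum_def inj_A_hat_minus_scale_iff[OF w]
            A_hat_minus_scale_dense_range)
  next
    case False
    then show ?thesis
      by (simp add: continuous_spectrum_def inj_A_hat_minus_scale_iff[OF w])
  qed
  then show ?thesis by blast
qed

lemma residual_spectrum_A_hat:
  assumes w: "w \<noteq> 0"
  shows "residual_spectrum cs_scale UNIV (A_hat w) = {}"
proof -
  have "z \<noteq> 0" if "norm w \<le> norm z" for z :: complex
    using that w by auto
  then show ?thesis
    unfolding residual_spectrum_def inj_A_hat_minus_scale_iff[OF w]
    using A_hat_minus_scale_dense_range by blast
qed

corollary spectrum_A_hat:
  assumes w: "w \<noteq> 0"
  shows "spectrum cs_scale UNIV (A_hat w) = {z. norm z \<le> norm w}"
  unfolding spectrum_def point_spectrum_A_hat[OF w] continuous_spectrum_A_hat[OF w]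
    residual_spectrum_A_hat[OF w]
  by auto

theorem theorem5p1:
  shows
    "(\<forall>w::real. norm w > 1 \<longrightarrow>
        Vector_Spaces.linear cs_scale cs_scale (A_hat w) \<and> bounded_linear (A_hat w) \<and>
        chaotic UNIV (A_hat w) \<and>
        (\<forall>n\<ge>1.
           (\<forall>x. \<forall>k\<ge>1. cs_nth ((A_hat w ^^ n) x) k
              = w ^ n * (cs_nth x (k + n) + cs_nth x n - 2 * cs_lim x)) \<and>
           chaotic UNIV (A_hat w ^^ n))) \<and>
     (\<forall>w::complex. norm w > 1 \<longrightarrow>
        Vector_Spaces.linear cs_scale cs_scale (A_hat w) \<and> bounded_linear (A_hat w) \<and>
        chaotic UNIV (A_hat w) \<and>
        (\<forall>n\<ge>1.
           (\<forall>x. \<forall>k\<ge>1. cs_nth ((A_hat w ^^ n) x) k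
              = w ^ n * (cs_nth x (k + n) + cs_nth x n - 2 * cs_lim x)) \<and>
           chaotic UNIV (A_hat w ^^ n)) \<and>
        spectrum cs_scale UNIV (A_hat w) = {z. norm z \<le> norm w} \<and>
        point_spectrum cs_scale UNIV (A_hat w) = {z. norm z < norm w} \<and>
        continuous_spectrum cs_scale UNIV (A_hat w) = {z. norm z = norm w})"
proof (intro conjI allI impI)
  fix w :: complex assume "norm w > 1"
  then have "w \<noteq> 0" by auto
  then show "spectrum cs_scale UNIV (A_hat w) = {z. norm z \<le> norm w}"
    "point_spectrum cs_scale UNIV (A_hat w) = {z. norm z < norm w}"
    "continuous_spectrum cs_scale UNIV (A_hat w) = {z. norm z = norm w}"
    by (simp_all add: spectrum_A_hat point_spectrum_A_hat continuous_spectrum_A_hat)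
qed (simp_all add: linear_A_hat bounded_linear_A_hat chaotic_A_hat chaotic_A_hat_funpow
       cs_nth_A_hat_funpow)

end
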